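(* Let $n,d\ge 1$. Every real Hessenberg input normal (HIN) pair $(A,B)$, with $A$ of size $n\times n$ and $B$ of size $n\times d$, has a representation $$(B\,|\,A)=(0_{n,d}\,|\,I_n)\,U^{(1)}(\theta_1,\ldots,\theta_d)\,V^{(2)}(\theta_{d+1},\ldots,\theta_{2d})\cdots V^{(n-1)}(\theta_{(n-2)d+1},\ldots,\theta_{(n-1)d})\,V^{(n)}(\theta_{(n-1)d+1},\ldots,\theta_{nd})$$ for some real angles $\theta_1,\ldots,\theta_{nd}$, where $0_{n,d}$ is the $n\times d$ zero matrix and $U^{(1)}$, $V^{(k)}$ are the $(n+d)\times(n+d)$ products of $d$ Givens rotations given by $$U^{(1)}(\theta_1,\ldots,\theta_d)=G_{d+1,1}(\theta_1)\,G_{1,2}(\theta_2)\cdots G_{d-2,d-1}(\theta_{d-1})\,G_{d-1,d}(\theta_d),$$ $$V^{(k)}(\theta_{(k-1)d+1},\ldots,\theta_{kd})=G_{k+d,k+d-1}(\theta_{(k-1)d+1})\,G_{k+d-1,d}(\theta_{(k-1)d+2})\,G_{d,d-1}(\theta_{(k-1)d+3})\cdots G_{4,3}(\theta_{kd-1})\,G_{3,2}(\theta_{kd}).$$ Conversely, every matrix of the form of the right-hand side of the displayed representation is a HIN pair.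
   Context: All matrices are real; $A^*$ denotes the transpose of $A$. $(B\,|\,A)$ denotes the $n\times(n+d)$ concatenation of $B$ with $A$; an $n\times(n+d)$ matrix is identified with the pair $(A,B)$ whose $B$ is its first $d$ columns and whose $A$ is its last $n$ columns. A pair $(A,B)$ is input normal if $AA^*+BB^*=I_n$. A pair $(A,B)$ is in Hessenberg form if $A$ is an (upper) Hessenberg matrix ($A_{i,j}=0$ for $i>j+1$), $B_{1,1}\ge 0$, and $B_{j,1}=0$ for $j>1$. A Hessenberg input normal (HIN) pair is a pair that is both in Hessenberg form and input normal. $G_{i,j}(\theta)$, $i\neq j$, is the $(n+d)\times(n+d)$ Givens rotation in coordinates $i$ and $j$, with entries $g_{i,i}=g_{j,j}=\cos\theta$, $g_{i,j}=-g_{j,i}=\sin\theta$, and $g_{k,m}=\delta_{k,m}$ otherwise. Each of $U^{(1)}$ and $V^{(k)}$ ($2\le k\le n$) has exactly $d$ factors. The $j$-th factor of $U^{(1)}$ is $G_{d+1,1}(\theta_1)$ for $j=1$ and $G_{j-1,j}(\theta_j)$ for $2\le j\le d$. The $j$-th factor of $V^{(k)}$ is $G_{k+d,k+d-1}(\theta_{(k-1)d+1})$ for $j=1$, $G_{k+d-1,d}(\theta_{(k-1)d+2})$ for $j=2$ (if $d\ge2$), and $G_{d-j+3,\,d-j+2}(\theta_{(k-1)d+j})$ for $3\le j\le d$.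
   Formalization: The converse fails for unrestricted angles since B_{1,1} may be negative (n=d=1, θ_1=-π/2 gives (-1|0)); proved instead: every such product is input normal, with A Hessenberg and B_{j,1}=0 for j>1, and is a HIN pair exactly when B_{1,1}≥0. *)

theory Defs
  imports Complex_Main "Jordan_Normal_Form.Matrix"
begin

text \<open>Matrices are those of \<open>Jordan_Normal_Form.Matrix\<close>, whose entries are numbered from 0:
  the mathematical entry in row \<open>i\<close> and column \<open>j\<close> is entry \<open>(i - 1, j - 1)\<close> of the matrix.
  The coordinates of a Givens rotation and the angles keep their mathematical numbering from 1.\<close>

definition append_cols :: "real mat \<Rightarrow> real mat \<Rightarrow> real mat" where
  "append_cols B A = four_block_mat B A (0\<^sub>m 0 (dim_col B)) (0\<^sub>m 0 (dim_col A))"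

definition input_normal :: "real mat \<Rightarrow> real mat \<Rightarrow> bool" where
  "input_normal A B \<longleftrightarrow> A * transpose_mat A + B * transpose_mat B = 1\<^sub>m (dim_row A)"

definition upper_hessenberg :: "real mat \<Rightarrow> bool" where
  "upper_hessenberg A \<longleftrightarrow> (\<forall>i<dim_row A. \<forall>j<dim_col A. j + 1 < i \<longrightarrow> A $$ (i, j) = 0)"

definition hessenberg_form :: "real mat \<Rightarrow> real mat \<Rightarrow> bool" where
  "hessenberg_form A B \<longleftrightarrow>
     upper_hessenberg A \<and> 0 \<le> B $$ (0, 0) \<and> (\<forall>j. 0 < j \<and> j < dim_row B \<longrightarrow> B $$ (j, 0) = 0)"

definition HIN_pair :: "nat \<Rightarrow> nat \<Rightarrow> real mat \<Rightarrow> real mat \<Rightarrow> bool" where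
  "HIN_pair n d A B \<longleftrightarrow>
     A \<in> carrier_mat n n \<and> B \<in> carrier_mat n d \<and> hessenberg_form A B \<and> input_normal A B"

definition givens :: "nat \<Rightarrow> nat \<Rightarrow> nat \<Rightarrow> real \<Rightarrow> real mat" where
  "givens N i j t = mat N N (\<lambda>(r, c). let k = r + 1; m = c + 1 in
     if k = i \<and> m = i \<or> k = j \<and> m = j then cos t
     else if k = i \<and> m = j then sin t
     else if k = j \<and> m = i then - sin t
     else if k = m then 1 else 0)"

definition mat_prod :: "nat \<Rightarrow> real mat list \<Rightarrow> real mat" where
  "mat_prod N Ms = foldr (*) Ms (1\<^sub>m N)"

definition U_factor :: "nat \<Rightarrow> nat \<Rightarrow> (nat \<Rightarrow> real) \<Rightarrow> nat \<Rightarrow> real mat" where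
  "U_factor n d \<theta> j =
     (if j = 1 then givens (n + d) (d + 1) 1 (\<theta> 1) else givens (n + d) (j - 1) j (\<theta> j))"

definition U_mat :: "nat \<Rightarrow> nat \<Rightarrow> (nat \<Rightarrow> real) \<Rightarrow> real mat" where
  "U_mat n d \<theta> = mat_prod (n + d) (map (U_factor n d \<theta>) [1..<d + 1])"

text \<open>Natural-number subtraction is exact for the indices \<open>k \<ge> 2\<close> and \<open>1 \<le> j \<le> d\<close> that are used.\<close>

definition V_factor :: "nat \<Rightarrow> nat \<Rightarrow> (nat \<Rightarrow> real) \<Rightarrow> nat \<Rightarrow> nat \<Rightarrow> real mat" where
  "V_factor n d \<theta> k j =
     (let t = \<theta> ((k - 1) * d + j) in
      if j = 1 then givens (n + d) (k + d) (k + d - 1) t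
      else if j = 2 then givens (n + d) (k + d - 1) d t
      else givens (n + d) (d + 3 - j) (d + 2 - j) t)"

definition V_mat :: "nat \<Rightarrow> nat \<Rightarrow> (nat \<Rightarrow> real) \<Rightarrow> nat \<Rightarrow> real mat" where
  "V_mat n d \<theta> k = mat_prod (n + d) (map (V_factor n d \<theta> k) [1..<d + 1])"

definition HIN_representation :: "nat \<Rightarrow> nat \<Rightarrow> (nat \<Rightarrow> real) \<Rightarrow> real mat" where
  "HIN_representation n d \<theta> =
     append_cols (0\<^sub>m n d) (1\<^sub>m n) * U_mat n d \<theta> * mat_prod (n + d) (map (V_mat n d \<theta>) [2..<n + 1])"

end

theory Submission
  imports Defs "Jordan_Normal_Form.Determinant"
begin

text \<open>Each of \<open>U\<close> and the \<open>V\<close> matrices is a chain of Givens rotations along a path of distinct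
  coordinates starting at \<open>k + d\<close> (with \<open>k = 1\<close> for \<open>U\<close>).  Such a chain leaves the other coordinates
  alone, and the row it assigns to the starting point can be any unit vector supported on the path:
  peel off the rotations from the end of the path by polar coordinates.  In a HIN pair whose rows
  below the \<open>k\<close>-th are already standard basis vectors, orthonormality and the Hessenberg zeros confine
  row \<open>k\<close> to the \<open>k\<close>-th path, so the pair arises through the \<open>k\<close>-th chain from one whose \<open>k\<close>-th row
  is a basis vector as well.  Read from \<open>k = n\<close> downwards, this yields the angles; read upwards, it
  shows that the products keep the zero pattern.\<close>

section \<open>Matrix products and single Givens rotations\<close>

lemma mat_prod_carrier:
  assumes "set Ms \<subseteq> carrier_mat N N"
  shows "mat_prod N Ms \<in> carrier_mat N N"
  using assms by (induction Ms) (auto simp: mat_prod_def intro!: mult_carrier_mat)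

lemma mat_prod_snoc:
  assumes "set Ms \<subseteq> carrier_mat N N" "A \<in> carrier_mat N N"
  shows "mat_prod N (Ms @ [A]) = mat_prod N Ms * A"
  using assms
proof (induction Ms)
  case Nil
  then show ?case by (simp add: mat_prod_def)
next
  case (Cons M Ms)
  have "M * (mat_prod N Ms * A) = M * mat_prod N Ms * A"
    using Cons.prems mat_prod_carrier[of Ms N] by (intro assoc_mult_mat[symmetric]) auto
  then show ?case using Cons by (simp add: mat_prod_def)
qed

lemma givens_carrier [simp]: "givens N i j t \<in> carrier_mat N N"
  by (simp add: givens_def)

text \<open>Only columns \<open>i\<close> and \<open>j\<close> can change, since every other column
  of a Givens rotation is a standard basis vector. The decrements turn coordinates counted from 1
  into matrix indices counted from 0.\<close>

lemma index_mult_givens: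
  assumes "M \<in> carrier_mat n N" "i \<noteq> j" "i \<in> {1..N}" "j \<in> {1..N}" "r < n" "c < N"
  shows "(M * givens N i j t) $$ (r, c) =
    (if c + 1 = i then cos t * M $$ (r, i - 1) - sin t * M $$ (r, j - 1)
     else if c + 1 = j then sin t * M $$ (r, i - 1) + cos t * M $$ (r, j - 1)
     else M $$ (r, c))"
proof -
  obtain i' j' where ij: "i = Suc i'" "j = Suc j'" "i' \<noteq> j'" "i' < N" "j' < N"
    using assms by (cases i; cases j) auto
  let ?f = "\<lambda>x. M $$ (r, x) * givens N i j t $$ (x, c)"
  have "(M * givens N i j t) $$ (r, c) = sum ?f {..<N}"
    using assms by (simp add: scalar_prod_def givens_def atLeast0LessThan)
  also have "\<dots> = sum ?f (if c \<in> {i', j'} then {i', j'} else {c})"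
    using ij assms(6) by (intro sum.mono_neutral_right) (auto simp: givens_def)
  finally show ?thesis
    using ij assms(6) by (auto simp: givens_def)
qed

lemma transpose_givens:
  assumes "i \<noteq> j"
  shows "transpose_mat (givens N i j t) = givens N i j (- t)"
  using assms by (intro eq_matI) (auto simp: givens_def Let_def)

section \<open>Orthogonal matrices\<close>

definition orthogonal_real_mat :: "nat \<Rightarrow> real mat \<Rightarrow> bool" where
  "orthogonal_real_mat N P \<longleftrightarrow> P \<in> carrier_mat N N \<and> P * transpose_mat P = 1\<^sub>m N"

lemma transpose_mult_orthogonal:
  assumes "orthogonal_real_mat N P"
  shows "transpose_mat P * P = 1\<^sub>m N"
  using assms unfolding orthogonal_real_mat_def
  by (intro mat_mult_left_right_inverse[of P N]) auto

text \<open>The inner factor \<open>P * transpose_mat P\<close> cancels. Rows thus keep their inner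
  products, so input normality survives every rotation.\<close>

lemma mult_orthogonal_gram:
  assumes "orthogonal_real_mat N P" "M \<in> carrier_mat n N"
  shows "(M * P) * transpose_mat (M * P) = M * transpose_mat M"
proof -
  have P: "P \<in> carrier_mat N N" "transpose_mat P \<in> carrier_mat N N"
    "P * transpose_mat P = 1\<^sub>m N"
    using assms by (auto simp: orthogonal_real_mat_def)
  have M: "M \<in> carrier_mat n N" "transpose_mat M \<in> carrier_mat N n"
    using assms by auto
  have "(M * P) * transpose_mat (M * P) = M * P * (transpose_mat P * transpose_mat M)"
    using transpose_mult[OF M(1) P(1)] by simp
  also have "\<dots> = M * (P * (transpose_mat P * transpose_mat M))"
    using P M by (intro assoc_mult_mat) auto
  also have "P * (transpose_mat P * transpose_mat M) = P * transpose_mat P * transpose_mat M"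
    using P M by (intro assoc_mult_mat[symmetric]) auto
  finally show ?thesis using P M by simp
qed

lemma orthogonal_givens:
  assumes "i \<noteq> j" "i \<in> {1..N}" "j \<in> {1..N}"
  shows "orthogonal_real_mat N (givens N i j t)"
proof -
  have sc: "cos t * cos t + sin t * sin t = 1" "sin t * sin t + cos t * cos t = 1"
    by (metis power2_eq_square sin_cos_squared_add2, metis power2_eq_square sin_cos_squared_add)
  have "givens N i j t * givens N i j (- t) = 1\<^sub>m N"
  proof (intro eq_matI)
    fix r c assume "r < dim_row (1\<^sub>m N :: real mat)" "c < dim_col (1\<^sub>m N :: real mat)"
    then have rc: "r < N" "c < N" by auto
    obtain i' j' where "i = Suc i'" "j = Suc j'" "i' \<noteq> j'" "i' < N" "j' < N"
      using assms by (cases i; cases j) auto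
    with rc assms show "(givens N i j t * givens N i j (- t)) $$ (r, c) = 1\<^sub>m N $$ (r, c)"
      by (subst index_mult_givens[of _ N]) (auto simp: givens_def sc)
  qed (simp_all add: givens_def)
  then show ?thesis using assms by (simp add: orthogonal_real_mat_def transpose_givens)
qed

section \<open>Chains of Givens rotations along a path\<close>

text \<open>The common shape of the \<open>U\<close> and \<open>V\<close> matrices: successive
  rotations share a coordinate along the path \<open>p 0, ..., p m\<close>, where \<open>m\<close>
  counts rotations, not coordinates.\<close>

definition givens_chain :: "nat \<Rightarrow> (nat \<Rightarrow> nat) \<Rightarrow> nat \<Rightarrow> (nat \<Rightarrow> real) \<Rightarrow> real mat" where
  "givens_chain N p m t =
     mat_prod N (map (\<lambda>j. givens N (p (j - 1)) (p j) (t j)) [1..<m + 1])"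

lemma givens_chain_0: "givens_chain N p 0 t = 1\<^sub>m N"
  by (simp add: givens_chain_def mat_prod_def)

lemma givens_chain_Suc:
  "givens_chain N p (Suc m) t = givens_chain N p m t * givens N (p m) (p (Suc m)) (t (Suc m))"
proof -
  have "givens_chain N p (Suc m) t =
    mat_prod N (map (\<lambda>j. givens N (p (j - 1)) (p j) (t j)) [1..<m + 1] @
      [givens N (p m) (p (Suc m)) (t (Suc m))])"
    by (simp add: givens_chain_def)
  also have "\<dots> = givens_chain N p m t * givens N (p m) (p (Suc m)) (t (Suc m))"
    unfolding givens_chain_def by (rule mat_prod_snoc) auto
  finally show ?thesis .
qed

lemma givens_chain_carrier [simp]: "givens_chain N p m t \<in> carrier_mat N N"
  unfolding givens_chain_def by (rule mat_prod_carrier) auto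

lemma givens_chain_cong:
  assumes "\<And>j. j \<le> m \<Longrightarrow> t j = t' j"
  shows "givens_chain N p m t = givens_chain N p m t'"
  unfolding givens_chain_def using assms by (intro arg_cong[of _ _ "mat_prod N"]) auto

text \<open>Injectivity makes each rotation act on two different coordinates, the second of which no
  earlier rotation has touched.\<close>

definition path_in :: "nat \<Rightarrow> (nat \<Rightarrow> nat) \<Rightarrow> nat \<Rightarrow> bool" where
  "path_in N p m \<longleftrightarrow> inj_on p {..m} \<and> p ` {..m} \<subseteq> {1..N}"

lemma path_in_SucD:
  assumes "path_in N p (Suc m)"
  shows "path_in N p m" "p m \<noteq> p (Suc m)" "p m \<in> {1..N}" "p (Suc m) \<in> {1..N}"
    "p (Suc m) \<notin> p ` {..m}"
  using assms by (auto simp: path_in_def inj_on_def atMost_Suc)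

lemma orthogonal_givens_chain:
  assumes "path_in N p m"
  shows "orthogonal_real_mat N (givens_chain N p m t)"
  using assms
proof (induction m)
  case 0
  then show ?case by (simp add: givens_chain_0 orthogonal_real_mat_def)
next
  case (Suc m)
  note p = path_in_SucD[OF Suc.prems]
  \<comment> \<open>The shorter chain takes the place of \<open>M\<close>: a further rotation keeps
    its Gram matrix, the identity.\<close>
  from mult_orthogonal_gram[OF orthogonal_givens[OF p(2-4)], of "givens_chain N p m t" N]
    Suc.IH[OF p(1)]
  show ?case
    by (auto simp: givens_chain_Suc orthogonal_real_mat_def intro!: mult_carrier_mat[of _ N N])
qed

lemma mult_givens_chain_Suc:
  assumes "M \<in> carrier_mat n N"
  shows "M * givens_chain N p (Suc m) t =
    M * givens_chain N p m t * givens N (p m) (p (Suc m)) (t (Suc m))"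
  unfolding givens_chain_Suc using assms
  by (intro assoc_mult_mat[of _ n N _ N _ N, symmetric]) auto

lemma mult_givens_chain_off_path:
  assumes "path_in N p m" "M \<in> carrier_mat n N" "r < n" "c < N" "c + 1 \<notin> p ` {..m}"
  shows "(M * givens_chain N p m t) $$ (r, c) = M $$ (r, c)"
  using assms
proof (induction m)
  case 0
  then show ?case by (simp add: givens_chain_0)
next
  case (Suc m)
  note p = path_in_SucD[OF Suc.prems(1)]
  have c: "c + 1 \<noteq> p m" "c + 1 \<noteq> p (Suc m)" "c + 1 \<notin> p ` {..m}"
    using Suc.prems(5) by (auto simp: atMost_Suc)
  have "(M * givens_chain N p (Suc m) t) $$ (r, c) = (M * givens_chain N p m t) $$ (r, c)"
    unfolding mult_givens_chain_Suc[OF Suc.prems(2)]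
    using Suc.prems p c by (subst index_mult_givens[of _ n]) auto
  then show ?case using Suc p c by simp
qed

text \<open>Mixing two zero entries gives zeros again, so a row vanishing on the whole path passes
  through every rotation unchanged.\<close>

lemma mult_givens_chain_zero_row:
  assumes "path_in N p m" "M \<in> carrier_mat n N" "r < n" "c < N"
    "\<And>j. j \<le> m \<Longrightarrow> M $$ (r, p j - 1) = 0"
  shows "(M * givens_chain N p m t) $$ (r, c) = M $$ (r, c)"
  using assms
proof (induction m arbitrary: c)
  case 0
  then show ?case by (simp add: givens_chain_0)
next
  case (Suc m)
  note p = path_in_SucD[OF Suc.prems(1)]
  have IH: "(M * givens_chain N p m t) $$ (r, x) = M $$ (r, x)" if "x < N" for x
    using Suc.IH[OF p(1)] Suc.prems that by auto
  have z: "M $$ (r, p m - 1) = 0" "M $$ (r, p (Suc m) - 1) = 0"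
    using Suc.prems(5) by auto
  have lt: "p m - 1 < N" "p (Suc m) - 1 < N" using p by auto
  have zc: "M $$ (r, c) = 0" if "c + 1 = p m \<or> c + 1 = p (Suc m)"
    using that z by (metis add_diff_cancel_right')
  show ?case
    unfolding mult_givens_chain_Suc[OF Suc.prems(2)]
    using Suc.prems(2-4) p z zc lt IH by (subst index_mult_givens[of _ n]) auto
qed

text \<open>The vector is built from the far end of the path: the last rotation alone feeds the last
  coordinate, and undoing it leaves a unit vector supported on the shorter path. A chain without
  rotations is the identity, whose starting row has entry 1; hence the sign condition for
  \<open>m = 0\<close>.\<close>

lemma givens_chain_start_row:
  assumes "path_in N p m" "\<And>c. c < N \<Longrightarrow> c + 1 \<notin> p ` {..m} \<Longrightarrow> v c = 0"
    "(\<Sum>j\<le>m. (v (p j - 1))\<^sup>2) = 1" "m = 0 \<Longrightarrow> 0 \<le> v (p 0 - 1)"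
  shows "\<exists>t. \<forall>c<N. givens_chain N p m t $$ (p 0 - 1, c) = v c"
  using assms
proof (induction m arbitrary: v)
  case 0
  then have "v (p 0 - 1) = 1" by (simp add: power2_eq_1_iff)
  moreover have "v c = 0" if "c < N" "c \<noteq> p 0 - 1" for c
    using 0 that by (auto simp: path_in_def)
  ultimately show ?case
    using 0 by (auto simp: givens_chain_0 path_in_def)
next
  case (Suc m)
  note p = path_in_SucD[OF Suc.prems(1)]
  define a b where "a = v (p m - 1)" and "b = v (p (Suc m) - 1)"
  \<comment> \<open>Polar coordinates of \<open>(a, b)\<close>, with \<open>\<rho>\<close>
    nonnegative to meet the sign condition when the recursion reaches \<open>m = 0\<close>.\<close>
  obtain \<rho> s where \<rho>: "0 \<le> \<rho>" "a = \<rho> * cos s" "b = \<rho> * sin s"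
    using rcis_cmod_Arg[of "Complex a b"]
    by (metis Re_rcis Im_rcis complex.sel norm_ge_zero)
  \<comment> \<open>The row before the last rotation: the pair \<open>(a, b)\<close> is turned back
    to \<open>(\<rho>, 0)\<close>.\<close>
  define w where "w = v(p m - 1 := \<rho>, p (Suc m) - 1 := 0)"
  have ne: "p j - 1 \<noteq> p k - 1" if "j \<le> Suc m" "k \<le> Suc m" "j \<noteq> k" for j k
  proof -
    have "p j \<in> {1..N}" "p k \<in> {1..N}" "p j \<noteq> p k"
      using Suc.prems(1) that by (auto simp: path_in_def inj_on_def)
    then show ?thesis by auto
  qed
  have w: "w (p j - 1) = (if j = m then \<rho> else v (p j - 1))" if "j \<le> m" for j
    using that ne[of j m] ne[of j "Suc m"] by (auto simp: w_def)
  have "\<exists>t. \<forall>c<N. givens_chain N p m t $$ (p 0 - 1, c) = w c"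
  proof (rule Suc.IH[OF p(1)])
    fix c assume c: "c < N" "c + 1 \<notin> p ` {..m}"
    show "w c = 0"
    proof (cases "c + 1 = p (Suc m)")
      case True
      then have "c = p (Suc m) - 1" by simp
      then show ?thesis by (simp add: w_def)
    next
      case False
      then have "v c = 0" using Suc.prems(2) c by (auto simp: atMost_Suc)
      moreover have "c \<noteq> p m - 1" using c p by auto
      ultimately show ?thesis by (simp add: w_def)
    qed
  next
    have "\<rho>\<^sup>2 = a\<^sup>2 + b\<^sup>2"
      unfolding \<rho>(2,3) power_mult_distrib distrib_left[symmetric] by simp
    moreover have "(\<Sum>j\<le>m. (w (p j - 1))\<^sup>2) = (\<Sum>j<m. (v (p j - 1))\<^sup>2) + \<rho>\<^sup>2"
      using w by (simp add: lessThan_Suc_atMost[symmetric])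
    moreover have "(\<Sum>j\<le>Suc m. (v (p j - 1))\<^sup>2) = (\<Sum>j<m. (v (p j - 1))\<^sup>2) + a\<^sup>2 + b\<^sup>2"
      by (simp add: lessThan_Suc_atMost[symmetric] a_def b_def)
    ultimately show "(\<Sum>j\<le>m. (w (p j - 1))\<^sup>2) = 1" using Suc.prems(3) by simp
  next
    assume "m = 0"
    then show "0 \<le> w (p 0 - 1)" using w[of 0] \<rho> by simp
  qed
  then obtain t where t: "\<And>c. c < N \<Longrightarrow> givens_chain N p m t $$ (p 0 - 1, c) = w c" by blast
  have eq: "givens_chain N p m (t(Suc m := s)) = givens_chain N p m t"
    by (rule givens_chain_cong) simp
  have lt: "p m - 1 < N" "p (Suc m) - 1 < N" using p by auto
  have "p 0 \<in> {1..N}" using Suc.prems(1) by (auto simp: path_in_def)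
  then have p0: "p 0 - 1 < N" by auto
  have "givens_chain N p (Suc m) (t(Suc m := s)) $$ (p 0 - 1, c) = v c" if "c < N" for c
  proof -
    have wm: "w (p m - 1) = \<rho>" "w (p (Suc m) - 1) = 0"
      using w[of m] by (simp_all add: w_def)
    \<comment> \<open>The last rotation sends \<open>(\<rho>, 0)\<close> to
      \<open>(\<rho> * cos s, \<rho> * sin s)\<close>, which is \<open>(a, b)\<close>.\<close>
    have "givens_chain N p (Suc m) (t(Suc m := s)) $$ (p 0 - 1, c) =
      (if c + 1 = p m then cos s * w (p m - 1) - sin s * w (p (Suc m) - 1)
       else if c + 1 = p (Suc m) then sin s * w (p m - 1) + cos s * w (p (Suc m) - 1)
       else w c)"
      unfolding givens_chain_Suc eq
      using p p0 that t lt by (subst index_mult_givens[of _ N]) auto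
    also have "\<dots> = v c"
    proof -
      consider "c + 1 = p m" | "c + 1 = p (Suc m)" | "c + 1 \<noteq> p m" "c + 1 \<noteq> p (Suc m)" by blast
      then show ?thesis
      proof cases
        case 1
        then have "c = p m - 1" by simp
        then show ?thesis using 1 wm \<rho> by (simp add: a_def)
      next
        case 2
        then have "c = p (Suc m) - 1" by simp
        then show ?thesis using 2 wm \<rho> p by (simp add: b_def)
      next
        case 3
        then have "c \<noteq> p m - 1" "c \<noteq> p (Suc m) - 1" using p by auto
        then show ?thesis using 3 by (simp add: w_def)
      qed
    qed
    finally show ?thesis .
  qed
  then show ?case by blast
qed

section \<open>Paths of the factors and partial products\<close>

text \<open>For \<open>k = 1\<close> the path is \<open>d + 1, 1, 2, ..., d\<close>. For
  \<open>k \<ge> 2\<close> it is \<open>k + d, k + d - 1, d, d - 1, ..., 2\<close>, which for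
  \<open>d = 1\<close> stops at \<open>k + d - 1\<close>.\<close>

definition HIN_path :: "nat \<Rightarrow> nat \<Rightarrow> nat \<Rightarrow> nat" where
  "HIN_path d k j =
     (if j = 0 then k + d else if k = 1 then j else if j = 1 then k + d - 1 else d + 2 - j)"

lemma HIN_path_0 [simp]: "HIN_path d k 0 = k + d"
  by (simp add: HIN_path_def)

text \<open>These are the columns where row \<open>k\<close> of a HIN pair can be nonzero once all
  later rows are basis vectors. Coordinate 1 is visited only for \<open>k = 1\<close>, when
  \<open>k + d - 1\<close> is \<open>d\<close> and already lies in the interval.\<close>

lemma HIN_path_image:
  assumes "1 \<le> k" "1 \<le> d"
  shows "HIN_path d k ` {..d} = {k + d, k + d - 1} \<union> {(if k = 1 then 1 else 2)..d}"
proof (cases "k = 1")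
  case True
  have "{..d} = insert 0 {1..d}" by auto
  moreover have "HIN_path d k ` {1..d} = {1..d}"
    using True by (auto simp: HIN_path_def)
  ultimately show ?thesis using True assms by auto
next
  case False
  have "{..d} = {0, 1} \<union> {2..d}" using assms by auto
  then have "HIN_path d k ` {..d} = HIN_path d k ` {0, 1} \<union> HIN_path d k ` {2..d}"
    by (simp only: image_Un)
  moreover have "HIN_path d k 1 = k + d - 1"
    using False by (auto simp: HIN_path_def)
  moreover have "HIN_path d k ` {2..d} = {2..d}"
  proof -
    have "(\<lambda>j. d + 2 - j) ` {2..d} = {2..d}"
    proof (intro equalityI subsetI)
      fix x assume "x \<in> {2..d}"
      then show "x \<in> (\<lambda>j. d + 2 - j) ` {2..d}" by (intro image_eqI[of _ _ "d + 2 - x"]) auto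
    qed auto
    moreover have "HIN_path d k ` {2..d} = (\<lambda>j. d + 2 - j) ` {2..d}"
      using False by (intro image_cong) (auto simp: HIN_path_def)
    ultimately show ?thesis by simp
  qed
  ultimately show ?thesis using False by simp
qed

lemma path_in_HIN_path:
  assumes "k \<in> {1..n}" "1 \<le> d"
  shows "path_in (n + d) (HIN_path d k) d"
  using assms HIN_path_image[of k d]
  by (auto simp: path_in_def inj_on_def HIN_path_def split: if_splits)

text \<open>Angles are indexed by chain and by position in the chain, so that adding a chain needs
  no arithmetic on a running index.\<close>

definition HIN_partial :: "nat \<Rightarrow> nat \<Rightarrow> (nat \<Rightarrow> nat \<Rightarrow> real) \<Rightarrow> nat \<Rightarrow> real mat" where
  "HIN_partial n d \<tau> k = append_cols (0\<^sub>m n d) (1\<^sub>m n) *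
     mat_prod (n + d) (map (\<lambda>i. givens_chain (n + d) (HIN_path d i) d (\<tau> i)) [1..<k + 1])"

lemma append_cols_carrier:
  assumes "A \<in> carrier_mat n n" "B \<in> carrier_mat n d"
  shows "append_cols B A \<in> carrier_mat n (n + d)"
  using assms by (auto simp: append_cols_def)

lemma append_cols_index:
  assumes "A \<in> carrier_mat n n" "B \<in> carrier_mat n d" "i < n" "c < n + d"
  shows "append_cols B A $$ (i, c) = (if c < d then B $$ (i, c) else A $$ (i, c - d))"
  using assms by (auto simp: append_cols_def)

lemma HIN_partial_0: "HIN_partial n d \<tau> 0 = append_cols (0\<^sub>m n d) (1\<^sub>m n)"
  using append_cols_carrier[of "1\<^sub>m n" n "0\<^sub>m n d" d] by (simp add: HIN_partial_def mat_prod_def)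

lemma HIN_partial_Suc:
  "HIN_partial n d \<tau> (Suc k) =
     HIN_partial n d \<tau> k * givens_chain (n + d) (HIN_path d (Suc k)) d (\<tau> (Suc k))"
proof -
  let ?C = "\<lambda>i. givens_chain (n + d) (HIN_path d i) d (\<tau> i)"
  have snoc: "map ?C [1..<Suc k + 1] = map ?C [1..<k + 1] @ [?C (Suc k)]" by simp
  have "mat_prod (n + d) (map ?C [1..<Suc k + 1]) =
    mat_prod (n + d) (map ?C [1..<k + 1]) * ?C (Suc k)"
    unfolding snoc by (rule mat_prod_snoc) auto
  moreover have "mat_prod (n + d) (map ?C [1..<k + 1]) \<in> carrier_mat (n + d) (n + d)"
    by (intro mat_prod_carrier) auto
  ultimately show ?thesis
    unfolding HIN_partial_def
    by (simp only: assoc_mult_mat[OF append_cols_carrier[OF one_carrier_mat zero_carrier_mat]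
          _ givens_chain_carrier])
qed

lemma HIN_partial_cong:
  assumes "\<And>i. i \<in> {1..k} \<Longrightarrow> \<tau> i = \<tau>' i"
  shows "HIN_partial n d \<tau> k = HIN_partial n d \<tau>' k"
proof -
  have "map (\<lambda>i. givens_chain (n + d) (HIN_path d i) d (\<tau> i)) [1..<k + 1] =
    map (\<lambda>i. givens_chain (n + d) (HIN_path d i) d (\<tau>' i)) [1..<k + 1]"
    using assms by auto
  then show ?thesis unfolding HIN_partial_def by metis
qed

text \<open>The factors agree one by one: \<open>U\<close> is the chain for index 1, each
  \<open>V\<close> matrix the chain for its own index. The running index of \<open>\<theta>\<close>
  lists the angles \<open>\<tau>\<close> chain by chain.\<close>

lemma HIN_representation_eq_partial:
  assumes "1 \<le> n" "1 \<le> d"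
    and \<theta>: "\<And>k j. k \<in> {1..n} \<Longrightarrow> j \<in> {1..d} \<Longrightarrow> \<theta> ((k - 1) * d + j) = \<tau> k j"
  shows "HIN_representation n d \<theta> = HIN_partial n d \<tau> n"
proof -
  let ?C = "\<lambda>i. givens_chain (n + d) (HIN_path d i) d (\<tau> i)"
  have U: "U_mat n d \<theta> = ?C 1"
    unfolding U_mat_def givens_chain_def
    by (intro arg_cong[of _ _ "mat_prod (n + d)"] map_cong)
      (use assms \<theta>[of 1] in \<open>auto simp: U_factor_def HIN_path_def\<close>)
  have V: "V_mat n d \<theta> k = ?C k" if "k \<in> {2..n}" for k
    unfolding V_mat_def givens_chain_def
  proof (intro arg_cong[of _ _ "mat_prod (n + d)"] map_cong refl)
    fix j assume "j \<in> set [1..<d + 1]"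
    then have j: "j \<in> {1..d}" by auto
    then have "\<theta> ((k - 1) * d + j) = \<tau> k j" using \<theta>[of k j] that by auto
    \<comment> \<open>Factor \<open>j\<close> joins path positions \<open>j - 1\<close> and
      \<open>j\<close>; the three cases follow the clauses of \<open>HIN_path\<close> for these
      positions.\<close>
    moreover consider "j = 1" | "j = 2" | "3 \<le> j" using j by force
    then have "HIN_path d k (j - 1) =
        (if j = 1 then k + d else if j = 2 then k + d - 1 else d + 3 - j) \<and>
      HIN_path d k j = (if j = 1 then k + d - 1 else d + 2 - j)"
      by cases (use that j in \<open>auto simp: HIN_path_def\<close>)
    ultimately show "V_factor n d \<theta> k j =
      givens (n + d) (HIN_path d k (j - 1)) (HIN_path d k j) (\<tau> k j)"
      by (auto simp: V_factor_def)
  qed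
  have "map (V_mat n d \<theta>) [2..<n + 1] = map ?C [2..<n + 1]" using V by auto
  moreover have "[1..<n + 1] = 1 # [2..<n + 1]"
    using assms by (simp add: upt_conv_Cons numeral_2_eq_2 del: upt_Suc)
  then have "mat_prod (n + d) (map ?C [1..<n + 1]) =
    ?C 1 * mat_prod (n + d) (map ?C [2..<n + 1])"
    by (simp add: mat_prod_def del: upt_Suc)
  moreover have "mat_prod (n + d) (map ?C [2..<n + 1]) \<in> carrier_mat (n + d) (n + d)"
    by (intro mat_prod_carrier) auto
  ultimately show ?thesis
    unfolding HIN_representation_def HIN_partial_def U
    by (simp only: assoc_mult_mat[OF append_cols_carrier[OF one_carrier_mat zero_carrier_mat]
          givens_chain_carrier])
qed

section \<open>Adding and splitting off one chain\<close>

text \<open>The invariant between chains, with rows counted from 0: rows from \<open>k\<close> on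
  are those of the initial matrix \<open>(0 | I)\<close>, earlier rows have the zeros of a HIN pair.
  For \<open>k = 0\<close> only the initial matrix qualifies; for \<open>k = n\<close> this is
  everything asked of a HIN pair except the sign of its corner entry.\<close>

definition partial_HIN :: "nat \<Rightarrow> nat \<Rightarrow> nat \<Rightarrow> real mat \<Rightarrow> bool" where
  "partial_HIN n d k M \<longleftrightarrow> M \<in> carrier_mat n (n + d) \<and> M * transpose_mat M = 1\<^sub>m n \<and>
     (\<forall>i c. k \<le> i \<and> i < n \<and> c < n + d \<longrightarrow> M $$ (i, c) = (if c = d + i then 1 else 0)) \<and>
     (\<forall>i. 0 < i \<and> i < k \<longrightarrow> M $$ (i, 0) = 0) \<and>
     (\<forall>i j. i < k \<and> j + 1 < i \<longrightarrow> M $$ (i, d + j) = 0)"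

lemma partial_HIN_0_iff:
  "partial_HIN n d 0 M \<longleftrightarrow> M = append_cols (0\<^sub>m n d) (1\<^sub>m n)"
proof
  assume "partial_HIN n d 0 M"
  then show "M = append_cols (0\<^sub>m n d) (1\<^sub>m n)"
    using append_cols_carrier[of "1\<^sub>m n" n "0\<^sub>m n d" d]
    by (intro eq_matI) (auto simp: partial_HIN_def append_cols_index[of _ n _ d])
next
  let ?E = "append_cols (0\<^sub>m n d) (1\<^sub>m n) :: real mat"
  assume M: "M = ?E"
  have E: "?E \<in> carrier_mat n (n + d)" by (simp add: append_cols_carrier)
  have idx: "?E $$ (i, c) = (if c = d + i then 1 else 0)" if "i < n" "c < n + d" for i c
    using that by (auto simp: append_cols_index[of _ n _ d])
  have "?E * transpose_mat ?E = 1\<^sub>m n"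
  proof (intro eq_matI)
    fix i j assume "i < dim_row (1\<^sub>m n :: real mat)" "j < dim_col (1\<^sub>m n :: real mat)"
    then have ij: "i < n" "j < n" by auto
    have "(?E * transpose_mat ?E) $$ (i, j) = (\<Sum>c<n + d. ?E $$ (i, c) * ?E $$ (j, c))"
      using E ij by (auto simp: scalar_prod_def atLeast0LessThan intro!: sum.cong)
    also have "\<dots> = (\<Sum>c<n + d. if c = d + i then (if i = j then 1 else 0) else 0)"
      using ij idx by (intro sum.cong) auto
    finally show "(?E * transpose_mat ?E) $$ (i, j) = 1\<^sub>m n $$ (i, j)"
      using ij by simp
  qed (use E in auto)
  then show "partial_HIN n d 0 M" using E idx M by (simp add: partial_HIN_def)
qed

text \<open>Later basis rows vanish on the path and are left alone. The required zeros lie off the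
  path: column 0 is on it only for \<open>k = 0\<close>, when no zero is demanded there, and the
  Hessenberg zeros in rows up to \<open>k\<close> lie left of the columns of \<open>A\<close> that
  it visits.\<close>

lemma partial_HIN_mult_chain:
  assumes "partial_HIN n d k M" "k < n" "1 \<le> d"
  shows "partial_HIN n d (Suc k) (M * givens_chain (n + d) (HIN_path d (Suc k)) d t)"
proof -
  let ?N = "n + d" and ?p = "HIN_path d (Suc k)"
  let ?C = "givens_chain ?N ?p d t"
  have p: "path_in ?N ?p d" using assms by (intro path_in_HIN_path) auto
  have im: "?p ` {..d} = {Suc k + d, k + d} \<union> {(if k = 0 then 1 else 2)..d}"
    using HIN_path_image[of "Suc k" d] assms by auto
  have M: "M \<in> carrier_mat n ?N" using assms by (simp add: partial_HIN_def)
  have off: "(M * ?C) $$ (i, c) = M $$ (i, c)"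
    if "i < n" "c < ?N" "c + 1 \<notin> ?p ` {..d}" for i c
    using mult_givens_chain_off_path[OF p M] that by blast
  have "M * ?C \<in> carrier_mat n ?N" using M by (intro mult_carrier_mat) auto
  moreover have "(M * ?C) * transpose_mat (M * ?C) = 1\<^sub>m n"
    using mult_orthogonal_gram[OF orthogonal_givens_chain[OF p] M] assms
    by (simp add: partial_HIN_def)
  moreover have "(M * ?C) $$ (i, c) = (if c = d + i then 1 else 0)"
    if ic: "Suc k \<le> i" "i < n" "c < ?N" for i c
  proof -
    have row: "M $$ (i, x) = (if x = d + i then 1 else 0)" if "x < ?N" for x
      using assms ic that by (auto simp: partial_HIN_def)
    have "M $$ (i, ?p j - 1) = 0" if "j \<le> d" for j
    proof -
      have "?p j \<in> {Suc k + d, k + d} \<union> {(if k = 0 then 1 else 2)..d}" using im that by blast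
      then have "?p j \<le> Suc k + d" "1 \<le> ?p j" using assms by (auto split: if_splits)
      then show ?thesis using ic assms by (subst row) auto
    qed
    then show ?thesis using mult_givens_chain_zero_row[OF p M ic(2,3)] row ic by simp
  qed
  moreover have "(M * ?C) $$ (i, 0) = 0" if "0 < i" "i < Suc k" for i
  proof -
    \<comment> \<open>Row \<open>k\<close> is still a basis vector with its 1 in column
      \<open>d + k\<close>, so its zeros are present before the chain acts.\<close>
    have "M $$ (i, 0) = 0" using assms that by (cases "i < k") (auto simp: partial_HIN_def)
    then show ?thesis using off[of i 0] that im assms by auto
  qed
  moreover have "(M * ?C) $$ (i, d + j) = 0" if "i < Suc k" "j + 1 < i" for i j
  proof -
    have "M $$ (i, d + j) = 0" using assms that by (cases "i < k") (auto simp: partial_HIN_def)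
    then show ?thesis using off[of i "d + j"] that im assms by auto
  qed
  ultimately show ?thesis by (auto simp: partial_HIN_def)
qed

text \<open>Row \<open>k\<close> is a unit vector supported on the path, so some chain has it as
  starting row. Multiplying by the transpose of this chain turns the row into a basis vector and
  keeps the rest of the structure.\<close>

lemma partial_HIN_factor:
  assumes S: "partial_HIN n d (Suc k) M" and k: "k < n" and d: "1 \<le> d"
  obtains M' t where "partial_HIN n d k M'"
    "M = M' * givens_chain (n + d) (HIN_path d (Suc k)) d t"
proof -
  let ?N = "n + d" and ?p = "HIN_path d (Suc k)"
  have p: "path_in ?N ?p d" using k d by (intro path_in_HIN_path) auto
  have im: "?p ` {..d} = {Suc k + d, k + d} \<union> {(if k = 0 then 1 else 2)..d}"
    using HIN_path_image[of "Suc k" d] d by auto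
  have M: "M \<in> carrier_mat n ?N" and gram: "M * transpose_mat M = 1\<^sub>m n"
    and unit_row: "\<And>i c. Suc k \<le> i \<Longrightarrow> i < n \<Longrightarrow> c < ?N \<Longrightarrow> M $$ (i, c) = (if c = d + i then 1 else 0)"
    and col0: "\<And>i. 0 < i \<Longrightarrow> i < Suc k \<Longrightarrow> M $$ (i, 0) = 0"
    and hess: "\<And>i j. i < Suc k \<Longrightarrow> j + 1 < i \<Longrightarrow> M $$ (i, d + j) = 0"
    using S by (auto simp: partial_HIN_def)
  have inner: "(\<Sum>c<?N. M $$ (i, c) * M $$ (j, c)) = (if i = j then 1 else 0)"
    if "i < n" "j < n" for i j
  proof -
    have "(M * transpose_mat M) $$ (i, j) = (\<Sum>c<?N. M $$ (i, c) * M $$ (j, c))"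
      using M that by (auto simp: scalar_prod_def atLeast0LessThan intro!: sum.cong)
    then show ?thesis using gram that by simp
  qed
  \<comment> \<open>Row \<open>k\<close> is orthogonal to the later rows, which are basis vectors;
    each inner product singles out one entry.\<close>
  have right_zero: "M $$ (k, d + j) = 0" if "k < j" "j < n" for j
  proof -
    have "(\<Sum>c<?N. M $$ (k, c) * M $$ (j, c)) = (\<Sum>c<?N. if c = d + j then M $$ (k, c) else 0)"
      using that unit_row[of j] by (intro sum.cong) auto
    then show ?thesis using inner[of k j] that k by simp
  qed
  \<comment> \<open>In \<open>B\<close> only column 0 can be off the path, and only for
    \<open>k > 0\<close>. In \<open>A\<close> the columns before the visited ones vanish by the
    Hessenberg form, those after by orthogonality.\<close>
  have supp: "M $$ (k, c) = 0" if c: "c < ?N" "c + 1 \<notin> ?p ` {..d}" for c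
  proof (cases "c < d")
    case True
    then show ?thesis using c im col0[of k] by (auto split: if_splits simp: not_le)
  next
    case False
    then obtain j where j: "c = d + j" by (metis le_Suc_ex not_less)
    with c im have "j \<noteq> k" "j + 1 \<noteq> k" by auto
    then consider "j + 1 < k" | "k < j" by linarith
    then show ?thesis by cases (use j c hess right_zero in auto)
  qed
  have "(\<Sum>j\<le>d. (M $$ (k, ?p j - 1))\<^sup>2) = (\<Sum>c\<in>(\<lambda>j. ?p j - 1) ` {..d}. (M $$ (k, c))\<^sup>2)"
  proof (subst sum.reindex)
    have "?p i \<ge> 1" if "i \<le> d" for i using p that by (auto simp: path_in_def)
    then show "inj_on (\<lambda>j. ?p j - 1) {..d}"
      using p unfolding path_in_def inj_on_def
      by (metis atMost_iff le_add_diff_inverse)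
  qed simp
  also have "\<dots> = (\<Sum>c<?N. (M $$ (k, c))\<^sup>2)"
  proof (intro sum.mono_neutral_left)
    show "(\<lambda>j. ?p j - 1) ` {..d} \<subseteq> {..<?N}" using p k by (force simp: path_in_def)
    show "\<forall>c\<in>{..<?N} - (\<lambda>j. ?p j - 1) ` {..d}. (M $$ (k, c))\<^sup>2 = 0"
    proof
      fix c assume c: "c \<in> {..<?N} - (\<lambda>j. ?p j - 1) ` {..d}"
      have "c + 1 \<notin> ?p ` {..d}"
      proof
        assume "c + 1 \<in> ?p ` {..d}"
        then obtain j where j: "c + 1 = ?p j" "j \<in> {..d}" by (rule imageE)
        then have "c = ?p j - 1" by linarith
        with c j(2) show False by blast
      qed
      then show "(M $$ (k, c))\<^sup>2 = 0" using supp c by simp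
    qed
  qed simp
  also have "\<dots> = 1" using inner[of k k] k by (simp add: power2_eq_square)
  \<comment> \<open>The chain has at least one rotation because \<open>1 \<le> d\<close>, which
    settles the sign condition.\<close>
  finally obtain t where t: "\<And>c. c < ?N \<Longrightarrow> givens_chain ?N ?p d t $$ (?p 0 - 1, c) = M $$ (k, c)"
    using givens_chain_start_row[OF p, of "\<lambda>c. M $$ (k, c)"] supp d by auto
  define C where "C = givens_chain ?N ?p d t"
  define M' where "M' = M * transpose_mat C"
  have orth: "orthogonal_real_mat ?N C" unfolding C_def by (rule orthogonal_givens_chain[OF p])
  have C: "C \<in> carrier_mat ?N ?N" "transpose_mat C \<in> carrier_mat ?N ?N"
    using orth by (auto simp: orthogonal_real_mat_def)
  have M': "M' \<in> carrier_mat n ?N" unfolding M'_def using M C by auto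
  have "M' * C = M * (transpose_mat C * C)"
    unfolding M'_def using M C by (intro assoc_mult_mat) auto
  then have eq: "M = M' * C" using M transpose_mult_orthogonal[OF orth] by simp
  have gram': "M' * transpose_mat M' = 1\<^sub>m n"
    using mult_orthogonal_gram[OF orth M'] gram eq by simp
  \<comment> \<open>Read from \<open>M = M' * C\<close>: the chain leaves the off-path columns of
    \<open>M'\<close> alone.\<close>
  have off: "M' $$ (i, c) = M $$ (i, c)" if "i < n" "c < ?N" "c + 1 \<notin> ?p ` {..d}" for i c
    using mult_givens_chain_off_path[OF p M' that, of t] eq by (simp add: C_def)
  \<comment> \<open>A row of \<open>M\<close> equal to row \<open>q\<close> of \<open>C\<close>
    becomes row \<open>q\<close> of \<open>C * transpose_mat C\<close>, hence a basis
    vector.\<close>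
  have row: "M' $$ (i, c) = (if c = q then 1 else 0)"
    if "i < n" "q < ?N" "c < ?N" "\<And>x. x < ?N \<Longrightarrow> M $$ (i, x) = C $$ (q, x)" for i q c
  proof -
    have "M' $$ (i, c) = (\<Sum>x<?N. M $$ (i, x) * C $$ (c, x))"
      unfolding M'_def using M C that
      by (auto simp: scalar_prod_def atLeast0LessThan intro!: sum.cong)
    also have "\<dots> = (\<Sum>x<?N. C $$ (q, x) * C $$ (c, x))"
      using that by simp
    also have "\<dots> = (C * transpose_mat C) $$ (q, c)"
      using C that by (auto simp: scalar_prod_def atLeast0LessThan intro!: sum.cong)
    finally show ?thesis using orth that by (auto simp: orthogonal_real_mat_def)
  qed
  have unit_row': "M' $$ (i, c) = (if c = d + i then 1 else 0)"
    if ic: "k \<le> i" "i < n" "c < ?N" for i c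
  proof (rule row)
    fix x assume x: "x < ?N"
    show "M $$ (i, x) = C $$ (d + i, x)"
    proof (cases "i = k")
      case True
      then show ?thesis using t[OF x] by (simp add: C_def add.commute)
    next
      \<comment> \<open>Column \<open>d + i\<close> and all later ones are off the path. Applying
        the chain to the identity shows that row \<open>d + i\<close> of \<open>C\<close> is a basis
        vector, as is row \<open>i\<close> of \<open>M\<close>.\<close>
      case False
      have "(1\<^sub>m ?N * C) $$ (d + i, x) = 1\<^sub>m ?N $$ (d + i, x)"
        unfolding C_def
      proof (rule mult_givens_chain_zero_row[OF p])
        fix j assume "j \<le> d"
        then have "?p j \<in> {Suc k + d, k + d} \<union> {(if k = 0 then 1 else 2)..d}" using im by blast
        then have "?p j \<le> Suc k + d" "1 \<le> ?p j" using d by (auto split: if_splits)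
        then show "1\<^sub>m ?N $$ (d + i, ?p j - 1) = (0 :: real)" using ic False by auto
      qed (use ic x in auto)
      then show ?thesis using unit_row[of i x] False ic x C by auto
    qed
  qed (use ic in auto)
  have "partial_HIN n d k M'"
    unfolding partial_HIN_def
  proof (intro conjI allI impI M' gram')
    fix i c assume "k \<le> i \<and> i < n \<and> c < ?N"
    then show "M' $$ (i, c) = (if c = d + i then 1 else 0)" using unit_row' by blast
  next
    fix i assume "0 < i \<and> i < k"
    then show "M' $$ (i, 0) = 0" using off[of i 0] col0[of i] im k d by auto
  next
    fix i j assume "i < k \<and> j + 1 < i"
    then show "M' $$ (i, d + j) = 0" using off[of i "d + j"] hess[of i j] im k by auto
  qed
  with eq show thesis using that unfolding C_def by blast
qed

text \<open>By induction on \<open>k\<close>: \<open>partial_HIN_factor\<close> splits off the last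
  chain, \<open>partial_HIN_mult_chain\<close> puts it back.\<close>

lemma partial_HIN_iff:
  assumes "k \<le> n" "1 \<le> d"
  shows "partial_HIN n d k M \<longleftrightarrow> (\<exists>\<tau>. M = HIN_partial n d \<tau> k)"
  using assms(1)
proof (induction k arbitrary: M)
  case 0
  then show ?case by (simp add: partial_HIN_0_iff HIN_partial_0)
next
  case (Suc k)
  let ?C = "givens_chain (n + d) (HIN_path d (Suc k)) d"
  show ?case
  proof
    assume "partial_HIN n d (Suc k) M"
    then obtain M' t where M': "partial_HIN n d k M'" "M = M' * ?C t"
      using partial_HIN_factor Suc.prems assms(2) by (metis Suc_le_lessD)
    then obtain \<tau> where "M' = HIN_partial n d \<tau> k" using Suc by auto
    \<comment> \<open>The angles of the new chain are stored in \<open>\<tau>\<close> without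
      disturbing the earlier chains.\<close>
    moreover have "HIN_partial n d \<tau> k = HIN_partial n d (\<tau>(Suc k := t)) k"
      by (rule HIN_partial_cong) auto
    ultimately have "M = HIN_partial n d (\<tau>(Suc k := t)) (Suc k)"
      using M' by (simp add: HIN_partial_Suc)
    then show "\<exists>\<tau>. M = HIN_partial n d \<tau> (Suc k)" by blast
  next
    assume "\<exists>\<tau>. M = HIN_partial n d \<tau> (Suc k)"
    then obtain \<tau> where "M = HIN_partial n d \<tau> k * ?C (\<tau> (Suc k))"
      by (auto simp: HIN_partial_Suc)
    moreover have "partial_HIN n d k (HIN_partial n d \<tau> k)" using Suc by auto
    ultimately show "partial_HIN n d (Suc k) M"
      using partial_HIN_mult_chain Suc.prems assms(2) by (metis Suc_le_lessD)
  qed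
qed

section \<open>Concatenated pairs and the representation\<close>

text \<open>The concatenation is a block matrix with empty lower blocks, so in the block product
  with its transpose only the upper left block has entries.\<close>

lemma input_normal_append_cols:
  assumes A: "A \<in> carrier_mat n n" and B: "B \<in> carrier_mat n d"
  shows "input_normal A B \<longleftrightarrow> append_cols B A * transpose_mat (append_cols B A) = 1\<^sub>m n"
proof -
  let ?Z = "0\<^sub>m 0 :: nat \<Rightarrow> real mat"
  have "append_cols B A * transpose_mat (append_cols B A) =
    four_block_mat B A (?Z d) (?Z n) *
    four_block_mat (transpose_mat B) (transpose_mat (?Z d)) (transpose_mat A) (transpose_mat (?Z n))"
    using A B by (simp add: append_cols_def
        transpose_four_block_mat[OF B A zero_carrier_mat zero_carrier_mat] del: zero_transpose_mat)
  also have "\<dots> = four_block_mat (B * transpose_mat B + A * transpose_mat A)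
      (B * transpose_mat (?Z d) + A * transpose_mat (?Z n))
      (?Z d * transpose_mat B + ?Z n * transpose_mat A)
      (?Z d * transpose_mat (?Z d) + ?Z n * transpose_mat (?Z n))"
    by (rule mult_four_block_mat) (use A B in auto)
  also have "\<dots> = A * transpose_mat A + B * transpose_mat B"
    using A B by (intro eq_matI) auto
  finally show ?thesis using A by (simp add: input_normal_def)
qed

lemma partial_HIN_append_cols:
  assumes A: "A \<in> carrier_mat n n" and B: "B \<in> carrier_mat n d" and "1 \<le> d"
  shows "partial_HIN n d n (append_cols B A) \<longleftrightarrow>
    input_normal A B \<and> upper_hessenberg A \<and> (\<forall>j. 0 < j \<and> j < n \<longrightarrow> B $$ (j, 0) = 0)"
proof -
  have B0: "append_cols B A $$ (i, 0) = B $$ (i, 0)" if "i < n" for i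
    using that assms by (simp add: append_cols_index[OF A B])
  have Aij: "append_cols B A $$ (i, d + j) = A $$ (i, j)" if "i < n" "j < n" for i j
    using that by (simp add: append_cols_index[OF A B])
  have "(\<forall>i. 0 < i \<and> i < n \<longrightarrow> append_cols B A $$ (i, 0) = 0) \<longleftrightarrow>
    (\<forall>j. 0 < j \<and> j < n \<longrightarrow> B $$ (j, 0) = 0)"
    using B0 by metis
  moreover have "(\<forall>i j. i < n \<and> j + 1 < i \<longrightarrow> append_cols B A $$ (i, d + j) = 0) \<longleftrightarrow>
    upper_hessenberg A"
  proof -
    have "j < n" if "i < n" "j + 1 < i" for i j using that by linarith
    then show ?thesis using Aij A unfolding upper_hessenberg_def by (metis carrier_matD)
  qed
  moreover have "append_cols B A \<in> carrier_mat n (n + d)" by (rule append_cols_carrier[OF A B])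
  moreover have vacuous: "(\<forall>i c. n \<le> i \<and> i < n \<and> c < n + d \<longrightarrow> P i c) \<longleftrightarrow> True" for P
    by auto
  ultimately show ?thesis
    unfolding partial_HIN_def input_normal_append_cols[OF A B] vacuous by blast
qed

text \<open>The corner entry of \<open>B\<close> comes from the first chain alone: it is
  \<open>sin (\<theta> 1)\<close> for \<open>d = 1\<close> and
  \<open>sin (\<theta> 1) * cos (\<theta> 2)\<close> otherwise. Arbitrary angles leave its sign
  open, so the converse gives the remaining HIN properties and reduces being a HIN pair to this
  sign.\<close>

theorem theorem3p2:
  fixes n d :: nat
  assumes "1 \<le> n" and "1 \<le> d"
  shows "(\<forall>A B. HIN_pair n d A B \<longrightarrow> (\<exists>\<theta>. append_cols B A = HIN_representation n d \<theta>)) \<and>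
    (\<forall>\<theta>. \<exists>A B. A \<in> carrier_mat n n \<and> B \<in> carrier_mat n d \<and>
       append_cols B A = HIN_representation n d \<theta> \<and>
       input_normal A B \<and> upper_hessenberg A \<and>
       (\<forall>j. 0 < j \<and> j < n \<longrightarrow> B $$ (j, 0) = 0) \<and>
       (HIN_pair n d A B \<longleftrightarrow> 0 \<le> B $$ (0, 0)))"
proof (intro conjI allI impI)
  fix A B assume HIN: "HIN_pair n d A B"
  then have "partial_HIN n d n (append_cols B A)"
    using partial_HIN_append_cols[of A n B d] assms
    by (auto simp: HIN_pair_def hessenberg_form_def)
  then obtain \<tau> where \<tau>: "append_cols B A = HIN_partial n d \<tau> n"
    using partial_HIN_iff[of n n d] assms by auto
  \<comment> \<open>Inverts the running index: \<open>x - 1 = (k - 1) * d + (j - 1)\<close> has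
    quotient \<open>k - 1\<close> and remainder \<open>j - 1\<close> on division by
    \<open>d\<close>.\<close>
  define \<theta> where "\<theta> x = \<tau> ((x - 1) div d + 1) ((x - 1) mod d + 1)" for x
  have "\<theta> ((k - 1) * d + j) = \<tau> k j" if kj: "k \<in> {1..n}" "j \<in> {1..d}" for k j
  proof -
    obtain j' where "j = Suc j'" "j' < d" using kj by (cases j) auto
    then show ?thesis using kj by (simp add: \<theta>_def)
  qed
  then have "HIN_representation n d \<theta> = HIN_partial n d \<tau> n"
    using HIN_representation_eq_partial assms by blast
  then show "\<exists>\<theta>. append_cols B A = HIN_representation n d \<theta>" using \<tau> by metis
next
  fix \<theta>
  define M where "M = HIN_representation n d \<theta>"
  have "M = HIN_partial n d (\<lambda>k j. \<theta> ((k - 1) * d + j)) n"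
    unfolding M_def using assms by (intro HIN_representation_eq_partial) auto
  then have S: "partial_HIN n d n M" using partial_HIN_iff[of n n d M] assms by auto
  then have Mc: "M \<in> carrier_mat n (n + d)" by (simp add: partial_HIN_def)
  define B where "B = mat n d (\<lambda>(i, j). M $$ (i, j))"
  define A where "A = mat n n (\<lambda>(i, j). M $$ (i, d + j))"
  have AB: "A \<in> carrier_mat n n" "B \<in> carrier_mat n d" by (simp_all add: A_def B_def)
  have "append_cols B A $$ (i, c) = M $$ (i, c)" if "i < n" "c < n + d" for i c
    using that by (simp add: append_cols_index[OF AB]) (auto simp: A_def B_def)
  then have M: "append_cols B A = M"
    using Mc append_cols_carrier[OF AB] by (intro eq_matI) auto
  then have props: "input_normal A B \<and> upper_hessenberg A \<and> (\<forall>j. 0 < j \<and> j < n \<longrightarrow> B $$ (j, 0) = 0)"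
    using S partial_HIN_append_cols[OF AB assms(2)] by simp
  moreover have "HIN_pair n d A B \<longleftrightarrow> 0 \<le> B $$ (0, 0)"
    using props AB by (auto simp: HIN_pair_def hessenberg_form_def)
  ultimately show "\<exists>A B. A \<in> carrier_mat n n \<and> B \<in> carrier_mat n d \<and>
       append_cols B A = HIN_representation n d \<theta> \<and>
       input_normal A B \<and> upper_hessenberg A \<and>
       (\<forall>j. 0 < j \<and> j < n \<longrightarrow> B $$ (j, 0) = 0) \<and>
       (HIN_pair n d A B \<longleftrightarrow> 0 \<le> B $$ (0, 0))"
    using AB M M_def by blast
qed

end
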